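(* Let $(M,g)$ be a Riemannian or Lorentzian manifold, $E$ a unitary vector field on $M$ (timelike in the Lorentzian case) such that $A_E$ is orthogonally normal, $\varepsilon=g(E,E)$, $t\in\mathbb{R}\setminus\{-\varepsilon\}$, and let $g_t$ be the canonical variation of $g$ along $E$. Then for every vector field $X$ orthogonal to $E$, $$g_t(R^t_{XE}E,X)=g(R_{XE}E,X)+t\left(\varepsilon\, g(\nabla_X (A_E(E)),X)-g(A_E(E),X)^2\right)+\frac{t(2\varepsilon+t)}{2}\left(g(A_E(X),A_E(X))-g(A_E^2(X),X)\right).$$
   Context: Lorentzian metrics have signature $(-,+,\dots,+)$. Unitary means $g(E,E)=\pm1$ ($\varepsilon=1$ in the Riemannian case, $\varepsilon=-1$ in the Lorentzian case). With $\omega=g(E,\cdot)$, the canonical variation is $g_t=g+t\,\omega\otimes\omega$, $t\ne-\varepsilon$. $\nabla$ is the Levi-Civita connection of $g$; $R$ and $R^t$ are the curvature tensors of $g$ and $g_t$, with the convention $R_{UV}W=\nabla_U\nabla_VW-\nabla_V\nabla_UW-\nabla_{[U,V]}W$. $A_E(V)=\nabla_VE$ (so $A_E(E)=\nabla_EE$), and $A_E^*$ is the $g$-adjoint of $A_E$. $A_E$ is orthogonally normal if $g(A_E(X),A_E(X))=g(A_E^{*\perp}(X),A_E^{*\perp}(X))$ for all $X\in E^\perp$, where $A_E^{*\perp}(X)$ is the component of $A_E^*(X)$ orthogonal to $E$. *)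

theory Defs
  imports "HOL-Analysis.Analysis" "HOL-Library.Function_Algebras"
begin

section \<open>Smooth manifolds\<close>

text \<open>
  A manifold is a Hausdorff, second countable type \<open>'a\<close> together with a smooth atlas modelled on a
  Euclidean space \<open>'b\<close>; its dimension is \<open>DIM('b)\<close>. A chart is a pair of a domain and a map.
\<close>

text \<open>Intended for open \<open>S\<close> only, where the derivative at \<open>x\<close> and the one within \<open>S\<close> coincide.\<close>

primrec Ck_on :: "nat \<Rightarrow> 'b::euclidean_space set \<Rightarrow> ('b \<Rightarrow> 'c::real_normed_vector) \<Rightarrow> bool" where
  "Ck_on 0 S f \<longleftrightarrow> continuous_on S f"
| "Ck_on (Suc k) S f \<longleftrightarrow>
     f differentiable_on S \<and> (\<forall>b\<in>Basis. Ck_on k S (\<lambda>x. frechet_derivative f (at x) b))"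

definition smooth_on :: "'b::euclidean_space set \<Rightarrow> ('b \<Rightarrow> 'c::real_normed_vector) \<Rightarrow> bool" where
  "smooth_on S f \<longleftrightarrow> (\<forall>k. Ck_on k S f)"

type_synonym ('a, 'b) chart = "'a set \<times> ('a \<Rightarrow> 'b)"

definition is_chart :: "('a::topological_space, 'b::euclidean_space) chart \<Rightarrow> bool" where
  "is_chart c \<longleftrightarrow> (case c of (U, \<phi>) \<Rightarrow>
     open U \<and> open (\<phi> ` U) \<and> (\<exists>\<psi>. homeomorphism U (\<phi> ` U) \<phi> \<psi>))"

definition smooth_atlas ::
  "('a::{t2_space,second_countable_topology}, 'b::euclidean_space) chart set \<Rightarrow> bool" where
  "smooth_atlas \<A> \<longleftrightarrow>
     (\<forall>c\<in>\<A>. is_chart c) \<and>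
     (\<Union>(U, \<phi>)\<in>\<A>. U) = UNIV \<and>
     (\<forall>(U, \<phi>)\<in>\<A>. \<forall>(V, \<psi>)\<in>\<A>. smooth_on (\<phi> ` (U \<inter> V)) (\<psi> \<circ> inv_into U \<phi>))"

definition smooth_functions :: "('a, 'b::euclidean_space) chart set \<Rightarrow> ('a \<Rightarrow> real) set" where
  "smooth_functions \<A> = {f. \<forall>(U, \<phi>)\<in>\<A>. smooth_on (\<phi> ` U) (f \<circ> inv_into U \<phi>)}"


section \<open>Tangent vectors and vector fields\<close>

text \<open>
  Tangent vectors at \<open>p\<close> are the derivations at \<open>p\<close> of the algebra of smooth functions. They are
  extended by \<open>0\<close> to non-smooth functions, so that equality of tangent vectors is equality of
  HOL functions.
\<close>

type_synonym 'a tvec = "('a \<Rightarrow> real) \<Rightarrow> real"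
type_synonym 'a vfield = "'a \<Rightarrow> 'a tvec"

definition tangent_space :: "('a, 'b::euclidean_space) chart set \<Rightarrow> 'a \<Rightarrow> 'a tvec set" where
  "tangent_space \<A> p = {v.
     (\<forall>f\<in>smooth_functions \<A>. \<forall>h\<in>smooth_functions \<A>. v (f + h) = v f + v h) \<and>
     (\<forall>c. \<forall>f\<in>smooth_functions \<A>. v (\<lambda>q. c * f q) = c * v f) \<and>
     (\<forall>f\<in>smooth_functions \<A>. \<forall>h\<in>smooth_functions \<A>. v (f * h) = f p * v h + h p * v f) \<and>
     (\<forall>f. f \<notin> smooth_functions \<A> \<longrightarrow> v f = 0)}"

definition vscale :: "real \<Rightarrow> 'a tvec \<Rightarrow> 'a tvec" where
  "vscale c v = (\<lambda>f. c * v f)"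

definition vector_fields :: "('a, 'b::euclidean_space) chart set \<Rightarrow> 'a vfield set" where
  "vector_fields \<A> = {X.
     (\<forall>p. X p \<in> tangent_space \<A> p) \<and>
     (\<forall>f\<in>smooth_functions \<A>. (\<lambda>p. X p f) \<in> smooth_functions \<A>)}"

definition apply_field :: "'a vfield \<Rightarrow> ('a \<Rightarrow> real) \<Rightarrow> 'a \<Rightarrow> real" where
  "apply_field X f = (\<lambda>p. X p f)"

definition fscale :: "('a \<Rightarrow> real) \<Rightarrow> 'a vfield \<Rightarrow> 'a vfield" where
  "fscale f X = (\<lambda>p. vscale (f p) (X p))"

definition lie_bracket :: "'a vfield \<Rightarrow> 'a vfield \<Rightarrow> 'a vfield" where
  "lie_bracket X Y = (\<lambda>p f. X p (apply_field Y f) - Y p (apply_field X f))"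


section \<open>Metrics\<close>

type_synonym 'a metric = "'a \<Rightarrow> 'a tvec \<Rightarrow> 'a tvec \<Rightarrow> real"

definition pairing :: "'a metric \<Rightarrow> 'a vfield \<Rightarrow> 'a vfield \<Rightarrow> 'a \<Rightarrow> real" where
  "pairing g X Y = (\<lambda>p. g p (X p) (Y p))"

definition symmetric_tensor :: "('a, 'b::euclidean_space) chart set \<Rightarrow> 'a metric \<Rightarrow> bool" where
  "symmetric_tensor \<A> g \<longleftrightarrow>
     (\<forall>p. \<forall>u\<in>tangent_space \<A> p. \<forall>v\<in>tangent_space \<A> p. g p u v = g p v u) \<and>
     (\<forall>p. \<forall>u\<in>tangent_space \<A> p. \<forall>v\<in>tangent_space \<A> p. \<forall>w\<in>tangent_space \<A> p.
        g p (u + v) w = g p u w + g p v w) \<and>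
     (\<forall>p c. \<forall>u\<in>tangent_space \<A> p. \<forall>v\<in>tangent_space \<A> p. g p (vscale c u) v = c * g p u v) \<and>
     (\<forall>X\<in>vector_fields \<A>. \<forall>Y\<in>vector_fields \<A>. pairing g X Y \<in> smooth_functions \<A>)"

definition riemannian_metric :: "('a, 'b::euclidean_space) chart set \<Rightarrow> 'a metric \<Rightarrow> bool" where
  "riemannian_metric \<A> g \<longleftrightarrow>
     symmetric_tensor \<A> g \<and> (\<forall>p. \<forall>v\<in>tangent_space \<A> p. v \<noteq> 0 \<longrightarrow> g p v v > 0)"

text \<open>Signature \<open>(-,+,\<dots>,+)\<close>: every tangent space has a basis \<open>e 0, \<dots>, e (n - 1)\<close> in which \<open>g\<close> is
  \<open>diag(-1,1,\<dots>,1)\<close>. Linear independence of \<open>e\<close> is implied by orthonormality.\<close>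

definition lorentzian_metric :: "('a, 'b::euclidean_space) chart set \<Rightarrow> 'a metric \<Rightarrow> bool" where
  "lorentzian_metric \<A> g \<longleftrightarrow>
     symmetric_tensor \<A> g \<and>
     (\<forall>p. \<exists>e :: nat \<Rightarrow> 'a tvec.
        (\<forall>i<DIM('b). e i \<in> tangent_space \<A> p) \<and>
        (\<forall>v\<in>tangent_space \<A> p. \<exists>c. v = (\<Sum>i<DIM('b). vscale (c i) (e i))) \<and>
        (\<forall>i<DIM('b). \<forall>j<DIM('b).
           g p (e i) (e j) = (if i \<noteq> j then 0 else if i = 0 then - 1 else 1)))"

definition unitary_field ::
  "('a, 'b::euclidean_space) chart set \<Rightarrow> 'a metric \<Rightarrow> 'a vfield \<Rightarrow> bool" where
  "unitary_field \<A> g E \<longleftrightarrow>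
     E \<in> vector_fields \<A> \<and> (\<forall>p. pairing g E E p = 1 \<or> pairing g E E p = - 1)"

definition timelike_field :: "'a metric \<Rightarrow> 'a vfield \<Rightarrow> bool" where
  "timelike_field g E \<longleftrightarrow> (\<forall>p. pairing g E E p < 0)"

definition orthogonal_fields ::
  "('a, 'b::euclidean_space) chart set \<Rightarrow> 'a metric \<Rightarrow> 'a vfield \<Rightarrow> 'a vfield set" where
  "orthogonal_fields \<A> g E = {X \<in> vector_fields \<A>. \<forall>p. pairing g X E p = 0}"

definition orthogonal_component :: "'a metric \<Rightarrow> 'a vfield \<Rightarrow> 'a vfield \<Rightarrow> 'a vfield" where
  "orthogonal_component g E V = V - fscale (\<lambda>p. pairing g V E p / pairing g E E p) E"

definition canonical_variation :: "'a metric \<Rightarrow> 'a vfield \<Rightarrow> real \<Rightarrow> 'a metric" where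
  "canonical_variation g E t = (\<lambda>p u v. g p u v + t * (g p (E p) u * g p (E p) v))"


section \<open>Connections and curvature\<close>

type_synonym 'a connection = "'a vfield \<Rightarrow> 'a vfield \<Rightarrow> 'a vfield"

definition affine_connection ::
  "('a, 'b::euclidean_space) chart set \<Rightarrow> 'a connection \<Rightarrow> bool" where
  "affine_connection \<A> D \<longleftrightarrow>
     (\<forall>X\<in>vector_fields \<A>. \<forall>Y\<in>vector_fields \<A>. D X Y \<in> vector_fields \<A>) \<and>
     (\<forall>X\<in>vector_fields \<A>. \<forall>Y\<in>vector_fields \<A>. \<forall>Z\<in>vector_fields \<A>.
        D (X + Y) Z = D X Z + D Y Z \<and> D X (Y + Z) = D X Y + D X Z) \<and>
     (\<forall>f\<in>smooth_functions \<A>. \<forall>X\<in>vector_fields \<A>. \<forall>Y\<in>vector_fields \<A>.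
        D (fscale f X) Y = fscale f (D X Y) \<and>
        D X (fscale f Y) = fscale (apply_field X f) Y + fscale f (D X Y))"

text \<open>For non-degenerate \<open>g\<close> this determines \<open>D\<close> uniquely on smooth vector fields; the values of \<open>D\<close>
  on other arguments are irrelevant.\<close>

definition levi_civita ::
  "('a, 'b::euclidean_space) chart set \<Rightarrow> 'a metric \<Rightarrow> 'a connection \<Rightarrow> bool" where
  "levi_civita \<A> g D \<longleftrightarrow>
     affine_connection \<A> D \<and>
     (\<forall>X\<in>vector_fields \<A>. \<forall>Y\<in>vector_fields \<A>. D X Y - D Y X = lie_bracket X Y) \<and>
     (\<forall>X\<in>vector_fields \<A>. \<forall>Y\<in>vector_fields \<A>. \<forall>Z\<in>vector_fields \<A>.
        apply_field X (pairing g Y Z) = pairing g (D X Y) Z + pairing g Y (D X Z))"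

definition curvature :: "'a connection \<Rightarrow> 'a vfield \<Rightarrow> 'a vfield \<Rightarrow> 'a vfield \<Rightarrow> 'a vfield" where
  "curvature D U V W = D U (D V W) - D V (D U W) - D (lie_bracket U V) W"

definition A_op :: "'a connection \<Rightarrow> 'a vfield \<Rightarrow> 'a vfield \<Rightarrow> 'a vfield" where
  "A_op D E V = D V E"

definition is_adjoint :: "('a, 'b::euclidean_space) chart set \<Rightarrow> 'a metric \<Rightarrow>
    ('a vfield \<Rightarrow> 'a vfield) \<Rightarrow> ('a vfield \<Rightarrow> 'a vfield) \<Rightarrow> bool" where
  "is_adjoint \<A> g A B \<longleftrightarrow>
     (\<forall>X\<in>vector_fields \<A>. B X \<in> vector_fields \<A>) \<and>
     (\<forall>X\<in>vector_fields \<A>. \<forall>Y\<in>vector_fields \<A>. pairing g (A X) Y = pairing g X (B Y))"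

text \<open>For a metric \<open>g\<close> the adjoint of a \<open>C\<^sup>\<infinity>\<close>-linear \<open>A\<close> exists and is unique on smooth vector fields, so
  the existential quantifier only names it.\<close>

definition orthogonally_normal :: "('a, 'b::euclidean_space) chart set \<Rightarrow> 'a metric \<Rightarrow> 'a vfield \<Rightarrow>
    ('a vfield \<Rightarrow> 'a vfield) \<Rightarrow> bool" where
  "orthogonally_normal \<A> g E A \<longleftrightarrow>
     (\<exists>B. is_adjoint \<A> g A B \<and>
        (\<forall>X\<in>orthogonal_fields \<A> g E.
           pairing g (A X) (A X) =
           pairing g (orthogonal_component g E (B X)) (orthogonal_component g E (B X))))"

end

theory Submission
  imports Defs
begin

text \<open>
  Write \<open>\<omega> = g(E, \<cdot>)\<close> and \<open>A U = \<nabla>\<^sub>U E\<close>, so that \<open>\<nabla>\<omega> = g(A \<cdot>, \<cdot>)\<close>. As \<open>\<nabla>g = 0\<close>, the metric \<open>g\<^sub>t\<close> has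
  \<open>(\<nabla>\<^sub>U g\<^sub>t)(V, W) = t (g(A U, V) \<omega>(W) + \<omega>(V) g(A U, W))\<close>. Both connections being torsion-free, the
  difference \<open>C(U, V) = \<nabla>\<^sup>t\<^sub>U V - \<nabla>\<^sub>U V\<close> is symmetric, and the usual cyclic summation recovers it from
  this formula (\<open>difference_of_connections\<close>).

  Since \<open>E\<close> has constant length, \<open>\<omega>(A U) = 0\<close>, and most terms of \<open>C\<close> drop out when \<open>E\<close> and a field
  \<open>X\<close> orthogonal to \<open>E\<close> are inserted. With the twist \<open>H = A X - (A\<^sup>* X)\<^sup>\<bottom>\<close>, where \<open>\<^sup>\<bottom>\<close> takes the
  component orthogonal to \<open>E\<close>, what remains is
  \<open>\<nabla>\<^sup>t\<^sub>E E = (1 + t\<epsilon>) A E\<close> and \<open>\<nabla>\<^sup>t\<^sub>X E = A X + (t\<epsilon>/2) H\<close>, both read as equalities of pairings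
  with test fields (\<open>variation_acceleration\<close>, \<open>variation_derivative_of_E\<close>).

  Metric compatibility turns \<open>g(R\<^sub>X\<^sub>E E, X)\<close> into derivatives of scalar functions and pairings of
  first covariant derivatives (\<open>pairing_curvature\<close>). Comparing this expression for \<open>g\<close> and \<open>g\<^sub>t\<close>,
  the terms containing \<open>\<nabla>\<^sub>E X\<close> cancel because \<open>d\<omega>\<close> is alternating, and one obtains
  (\<open>variation_curvature\<close>)
  \<open>t\<epsilon> g(\<nabla>\<^sub>X(A E), X) - t g(A E, X)\<^sup>2 + (t\<epsilon>/2) (2 g(A X, H) + (t\<epsilon>/2) g(H, H))\<close>.
  Here \<open>g(A X, H) = g(A X, A X) - g(A\<^sup>2 X, X)\<close>. Orthogonal normality says that the two parts of
  \<open>H\<close> have the same square, whence \<open>g(H, H) = 2 g(A X, H)\<close> (\<open>twist_square\<close>); with \<open>\<epsilon>\<^sup>2 = 1\<close> the last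
  summand is the one claimed.
\<close>

section \<open>The algebra of smooth functions\<close>

text \<open>
  On an open set the derivative at a point depends on the values of the function in the set only.
  This allows the derivative of a sum or a product to be replaced by its expansion, which is the way
  the closure properties below are proved.
\<close>

lemma Ck_on_cong:
  assumes "open S" and "\<And>x. x \<in> S \<Longrightarrow> f x = h x" and "Ck_on k S f"
  shows "Ck_on k S h"
  using assms(2,3)
proof (induction k arbitrary: f h)
  case 0
  then show ?case by (simp cong: continuous_on_cong)
next
  case (Suc k)
  have D: "f differentiable at x" if "x \<in> S" for x
    using Suc.prems(2) that \<open>open S\<close> by (simp add: differentiable_on_eq_differentiable_at)
  have der: "(h has_derivative frechet_derivative f (at x)) (at x)" if "x \<in> S" for x
    using D[OF that] that \<open>open S\<close> Suc.prems(1)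
    by (metis frechet_derivative_works has_derivative_transform_within_open)
  have eq: "frechet_derivative f (at x) = frechet_derivative h (at x)" if "x \<in> S" for x
    using frechet_derivative_at[OF der[OF that]] .
  have "h differentiable_on S"
    using der \<open>open S\<close> unfolding differentiable_on_eq_differentiable_at[OF \<open>open S\<close>]
    by (auto simp: differentiable_def)
  moreover have "Ck_on k S (\<lambda>x. frechet_derivative h (at x) b)" if "b \<in> Basis" for b
    using Suc.IH[of "\<lambda>x. frechet_derivative f (at x) b"] Suc.prems(2) eq that by simp
  ultimately show ?case by simp
qed

lemma Ck_on_SucD: "Ck_on (Suc k) S f \<Longrightarrow> Ck_on k S f"
  by (induction k arbitrary: f) (auto intro: differentiable_imp_continuous_on)

lemma Ck_on_const: "open S \<Longrightarrow> Ck_on k S (\<lambda>x. c)"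
proof (induction k arbitrary: c)
  case (Suc k)
  then show ?case
    by (auto simp: differentiable_on_def frechet_derivative_const)
qed simp

lemma Ck_on_add:
  assumes "open S" "Ck_on k S f" "Ck_on k S h"
  shows "Ck_on k S (\<lambda>x. f x + h x)"
  using assms(2,3)
proof (induction k arbitrary: f h)
  case 0
  then show ?case by (simp add: continuous_on_add)
next
  case (Suc k)
  have d: "f differentiable at x" "h differentiable at x" if "x \<in> S" for x
    using Suc.prems that \<open>open S\<close> by (auto simp: differentiable_on_eq_differentiable_at)
  have "Ck_on k S (\<lambda>x. frechet_derivative (\<lambda>x. f x + h x) (at x) b)" if "b \<in> Basis" for b
  proof (rule Ck_on_cong[OF \<open>open S\<close>])
    show "Ck_on k S (\<lambda>x. frechet_derivative f (at x) b + frechet_derivative h (at x) b)"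
      using Suc that by simp
    show "frechet_derivative f (at x) b + frechet_derivative h (at x) b =
        frechet_derivative (\<lambda>x. f x + h x) (at x) b" if "x \<in> S" for x
      using fun_cong[OF frechet_derivative_at[OF has_derivative_add
        [OF d[OF that, unfolded frechet_derivative_works]]]] .
  qed
  then show ?case using Suc.prems by (simp add: differentiable_on_add)
qed

lemma Ck_on_mult:
  fixes f h :: "'b::euclidean_space \<Rightarrow> real"
  assumes "open S" "Ck_on k S f" "Ck_on k S h"
  shows "Ck_on k S (\<lambda>x. f x * h x)"
  using assms(2,3)
proof (induction k arbitrary: f h)
  case 0
  then show ?case by (simp add: continuous_on_mult)
next
  case (Suc k)
  have d: "f differentiable at x" "h differentiable at x" if "x \<in> S" for x
    using Suc.prems that \<open>open S\<close> by (auto simp: differentiable_on_eq_differentiable_at)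
  have "Ck_on k S (\<lambda>x. frechet_derivative (\<lambda>x. f x * h x) (at x) b)" if "b \<in> Basis" for b
  proof (rule Ck_on_cong[OF \<open>open S\<close>])
    show "Ck_on k S (\<lambda>x. f x * frechet_derivative h (at x) b + frechet_derivative f (at x) b * h x)"
      using Suc.prems that
      by (intro Ck_on_add[OF \<open>open S\<close>] Suc.IH) (auto intro: Ck_on_SucD[of k S])
    show "f x * frechet_derivative h (at x) b + frechet_derivative f (at x) b * h x =
        frechet_derivative (\<lambda>x. f x * h x) (at x) b" if "x \<in> S" for x
      using fun_cong[OF frechet_derivative_at[OF has_derivative_mult
        [OF d[OF that, unfolded frechet_derivative_works]]]] .
  qed
  then show ?case
    using Suc.prems by (auto intro!: differentiable_on_mult)
qed

context
  fixes \<A> :: "('a::{t2_space,second_countable_topology}, 'b::euclidean_space) chart set"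
  assumes atlas: "smooth_atlas \<A>"
begin

lemma chart_image_open: "(U, \<phi>) \<in> \<A> \<Longrightarrow> open (\<phi> ` U)"
  using atlas unfolding smooth_atlas_def is_chart_def by auto

lemma smooth_functions_const: "(\<lambda>q. c) \<in> smooth_functions \<A>"
  unfolding smooth_functions_def smooth_on_def
  by (auto simp: o_def intro!: Ck_on_const chart_image_open)

lemma smooth_functions_add:
  assumes "f \<in> smooth_functions \<A>" "h \<in> smooth_functions \<A>"
  shows "f + h \<in> smooth_functions \<A>"
  using assms unfolding smooth_functions_def smooth_on_def
  by (force simp: o_def plus_fun_def intro!: Ck_on_add chart_image_open)

lemma smooth_functions_mult:
  assumes "f \<in> smooth_functions \<A>" "h \<in> smooth_functions \<A>"
  shows "f * h \<in> smooth_functions \<A>"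
  using assms unfolding smooth_functions_def smooth_on_def
  by (force simp: o_def times_fun_def intro!: Ck_on_mult chart_image_open)

lemma smooth_functions_scale:
  assumes "f \<in> smooth_functions \<A>"
  shows "(\<lambda>q. c * f q) \<in> smooth_functions \<A>"
  using smooth_functions_mult[OF smooth_functions_const assms, of c] by (simp add: times_fun_def)

section \<open>The module of vector fields\<close>

lemma vector_field_tangent: "X \<in> vector_fields \<A> \<Longrightarrow> X p \<in> tangent_space \<A> p"
  unfolding vector_fields_def by auto

lemma tangent_space_diff:
  assumes "u \<in> tangent_space \<A> p" "v \<in> tangent_space \<A> p"
  shows "u - v \<in> tangent_space \<A> p"
  using assms unfolding tangent_space_def by (auto simp: algebra_simps)

lemma tangent_space_vscale:
  assumes "v \<in> tangent_space \<A> p"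
  shows "vscale c v \<in> tangent_space \<A> p"
  using assms unfolding tangent_space_def vscale_def by (auto simp: algebra_simps)

lemma vector_fields_fscale:
  assumes f: "f \<in> smooth_functions \<A>" and X: "X \<in> vector_fields \<A>"
  shows "fscale f X \<in> vector_fields \<A>"
proof -
  have "(\<lambda>p. fscale f X p h) \<in> smooth_functions \<A>" if "h \<in> smooth_functions \<A>" for h
    using smooth_functions_mult[OF f, of "\<lambda>p. X p h"] X that
    by (auto simp: vector_fields_def fscale_def vscale_def times_fun_def)
  then show ?thesis
    using X by (auto simp: vector_fields_def fscale_def intro: tangent_space_vscale)
qed

lemma vector_fields_diff:
  assumes X: "X \<in> vector_fields \<A>" and Y: "Y \<in> vector_fields \<A>"
  shows "X - Y \<in> vector_fields \<A>"
proof -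
  have "(\<lambda>p. (X - Y) p h) \<in> smooth_functions \<A>" if "h \<in> smooth_functions \<A>" for h
    using smooth_functions_add[of "\<lambda>p. X p h" "\<lambda>p. (-1) * Y p h"]
      smooth_functions_scale[of "\<lambda>p. Y p h" "-1"] X Y that
    by (auto simp: vector_fields_def plus_fun_def)
  then show ?thesis
    using X Y by (auto simp: vector_fields_def intro: tangent_space_diff)
qed

lemma vector_fields_orthogonal_component:
  assumes E: "E \<in> vector_fields \<A>" and V: "V \<in> vector_fields \<A>"
    and "pairing g V E \<in> smooth_functions \<A>" and eps: "\<And>p. pairing g E E p = \<epsilon>"
  shows "orthogonal_component g E V \<in> vector_fields \<A>"
  unfolding orthogonal_component_def eps
  using smooth_functions_scale[OF assms(3), of "inverse \<epsilon>"]
  by (intro vector_fields_diff V vector_fields_fscale E) (simp add: divide_inverse mult.commute)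

lemma apply_field_add_scale:
  assumes "X \<in> vector_fields \<A>" "f \<in> smooth_functions \<A>" "h \<in> smooth_functions \<A>"
  shows "apply_field X (\<lambda>q. f q + c * h q) p = apply_field X f p + c * apply_field X h p"
proof -
  have "X p (f + (\<lambda>q. c * h q)) = X p f + X p (\<lambda>q. c * h q)"
    using vector_field_tangent[OF assms(1), of p] assms(2) smooth_functions_scale[OF assms(3)]
    unfolding tangent_space_def by blast
  then show ?thesis
    using vector_field_tangent[OF assms(1), of p] assms(3)
    unfolding tangent_space_def apply_field_def plus_fun_def by auto
qed

lemma apply_field_scale:
  assumes "X \<in> vector_fields \<A>" "h \<in> smooth_functions \<A>"
  shows "apply_field X (\<lambda>q. c * h q) p = c * apply_field X h p"
  using vector_field_tangent[OF assms(1), of p] assms(2)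
  unfolding tangent_space_def apply_field_def by auto

lemma apply_field_mult:
  assumes "X \<in> vector_fields \<A>" "f \<in> smooth_functions \<A>" "h \<in> smooth_functions \<A>"
  shows "apply_field X (\<lambda>q. f q * h q) p = f p * apply_field X h p + h p * apply_field X f p"
proof -
  have "X p (f * h) = f p * X p h + h p * X p f"
    using vector_field_tangent[OF assms(1), of p] assms(2,3)
    unfolding tangent_space_def by blast
  then show ?thesis unfolding apply_field_def times_fun_def .
qed

lemma apply_field_const:
  assumes X: "X \<in> vector_fields \<A>"
  shows "apply_field X (\<lambda>q. c) p = 0"
proof -
  \<comment> \<open>The Leibniz rule for \<open>1 * 1\<close>.\<close>
  have "apply_field X (\<lambda>q. 1) p = 0"
    using apply_field_mult[OF X smooth_functions_const smooth_functions_const, of 1 1 p] by simp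
  then show ?thesis
    using apply_field_scale[OF X smooth_functions_const, of c 1 p] by simp
qed

section \<open>Pairings of vector fields\<close>

lemma pairing_sym:
  assumes "symmetric_tensor \<A> g" "X \<in> vector_fields \<A>" "Y \<in> vector_fields \<A>"
  shows "pairing g X Y p = pairing g Y X p"
  using assms vector_field_tangent unfolding symmetric_tensor_def pairing_def by blast

lemma pairing_smooth:
  assumes "symmetric_tensor \<A> g" "X \<in> vector_fields \<A>" "Y \<in> vector_fields \<A>"
  shows "pairing g X Y \<in> smooth_functions \<A>"
  using assms unfolding symmetric_tensor_def by blast

lemma pairing_fscale_left:
  assumes "symmetric_tensor \<A> g" "X \<in> vector_fields \<A>" "Y \<in> vector_fields \<A>"
  shows "pairing g (fscale f X) Y p = f p * pairing g X Y p"
  using assms vector_field_tangent unfolding symmetric_tensor_def pairing_def fscale_def by blast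

lemma pairing_diff_left:
  assumes g: "symmetric_tensor \<A> g"
    and X: "X \<in> vector_fields \<A>" and Y: "Y \<in> vector_fields \<A>" and Z: "Z \<in> vector_fields \<A>"
  shows "pairing g (X - Y) Z p = pairing g X Z p - pairing g Y Z p"
proof -
  have "g p (X p - Y p + Y p) (Z p) = g p (X p - Y p) (Z p) + g p (Y p) (Z p)"
    using g vector_field_tangent[OF X, of p] vector_field_tangent[OF Y, of p]
      vector_field_tangent[OF Z, of p] tangent_space_diff
    unfolding symmetric_tensor_def by blast
  then show ?thesis by (simp add: pairing_def)
qed

lemma pairing_diff_right:
  assumes g: "symmetric_tensor \<A> g"
    and X: "X \<in> vector_fields \<A>" and Y: "Y \<in> vector_fields \<A>" and Z: "Z \<in> vector_fields \<A>"
  shows "pairing g Z (X - Y) p = pairing g Z X p - pairing g Z Y p"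
  using pairing_diff_left[OF g X Y Z] pairing_sym[OF g] X Y Z vector_fields_diff by metis


section \<open>Metric connections\<close>

lemma levi_civita_closed:
  assumes "levi_civita \<A> g D" "X \<in> vector_fields \<A>" "Y \<in> vector_fields \<A>"
  shows "D X Y \<in> vector_fields \<A>"
  using assms unfolding levi_civita_def affine_connection_def by blast

lemma levi_civita_compatible:
  assumes "levi_civita \<A> g D" "X \<in> vector_fields \<A>" "Y \<in> vector_fields \<A>"
    and "Z \<in> vector_fields \<A>"
  shows "apply_field X (pairing g Y Z) p = pairing g (D X Y) Z p + pairing g Y (D X Z) p"
  using assms unfolding levi_civita_def by (simp add: plus_fun_def)

lemma levi_civita_torsion_free:
  assumes "levi_civita \<A> g D" "X \<in> vector_fields \<A>" "Y \<in> vector_fields \<A>"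
  shows "lie_bracket X Y = D X Y - D Y X"
  using assms unfolding levi_civita_def by simp

lemma levi_civita_lie_bracket_closed:
  assumes "levi_civita \<A> g D" "X \<in> vector_fields \<A>" "Y \<in> vector_fields \<A>"
  shows "lie_bracket X Y \<in> vector_fields \<A>"
  unfolding levi_civita_torsion_free[OF assms]
  by (intro vector_fields_diff levi_civita_closed[OF assms(1)] assms)

text \<open>
  The outer derivatives of the curvature tensor are moved to the scalar functions
  \<open>g(\<nabla>\<^sub>V W, Z)\<close> and to \<open>Z\<close>. Hence the curvature of \<open>g\<^sub>t\<close> can be computed from the pairings
  \<open>g\<^sub>t(\<nabla>\<^sup>t\<^sub>U V, W)\<close>, and no expression for \<open>\<nabla>\<^sup>t\<^sub>U V\<close> itself has to be found.
\<close>

lemma pairing_curvature: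
  assumes g: "symmetric_tensor \<A> g" and D: "levi_civita \<A> g D"
    and U: "U \<in> vector_fields \<A>" and V: "V \<in> vector_fields \<A>"
    and W: "W \<in> vector_fields \<A>" and Z: "Z \<in> vector_fields \<A>"
  shows "pairing g (curvature D U V W) Z p =
      (apply_field U (pairing g (D V W) Z) p - pairing g (D V W) (D U Z) p)
    - (apply_field V (pairing g (D U W) Z) p - pairing g (D U W) (D V Z) p)
    - pairing g (D (lie_bracket U V) W) Z p"
proof -
  note field_closed = levi_civita_closed[OF D] levi_civita_lie_bracket_closed[OF D] vector_fields_diff
  show ?thesis
    unfolding curvature_def
    by (simp add: pairing_diff_left[OF g] levi_civita_compatible[OF D] field_closed U V W Z)
qed

section \<open>The connection of the canonical variation\<close>

lemma pairing_canonical_variation: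
  "pairing (canonical_variation g E t) U V p =
    pairing g U V p + t * (pairing g E U p * pairing g E V p)"
  by (simp add: pairing_def canonical_variation_def)

text \<open>
  This makes the rules for pairings and \<open>pairing_curvature\<close> applicable to \<open>g\<^sub>t\<close>.
\<close>

lemma symmetric_tensor_canonical_variation:
  assumes g: "symmetric_tensor \<A> g" and E: "E \<in> vector_fields \<A>"
  shows "symmetric_tensor \<A> (canonical_variation g E t)"
proof -
  have lin: "g p (E p) (u + v) = g p (E p) u + g p (E p) v"
      "g p (E p) (vscale c u) = c * g p (E p) u"
    if "u \<in> tangent_space \<A> p" "v \<in> tangent_space \<A> p" for p u v c
  proof -
    have uv: "u + v \<in> tangent_space \<A> p"
      using that unfolding tangent_space_def by (auto simp: algebra_simps)
    have sym: "g p (E p) w = g p w (E p)" if "w \<in> tangent_space \<A> p" for w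
      using g vector_field_tangent[OF E] that unfolding symmetric_tensor_def by blast
    show "g p (E p) (u + v) = g p (E p) u + g p (E p) v"
      using g vector_field_tangent[OF E] that sym uv unfolding symmetric_tensor_def by metis
    show "g p (E p) (vscale c u) = c * g p (E p) u"
      using g vector_field_tangent[OF E] that sym tangent_space_vscale
      unfolding symmetric_tensor_def by metis
  qed
  have smooth: "pairing (canonical_variation g E t) X Y \<in> smooth_functions \<A>"
    if "X \<in> vector_fields \<A>" "Y \<in> vector_fields \<A>" for X Y
  proof -
    have "pairing (canonical_variation g E t) X Y =
        pairing g X Y + (\<lambda>q. t * (pairing g E X * pairing g E Y) q)"
      by (simp add: fun_eq_iff pairing_canonical_variation)
    then show ?thesis
      using that
      by (simp only: smooth_functions_add smooth_functions_scale smooth_functions_mult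
          pairing_smooth[OF g] E)
  qed
  show ?thesis
    using g lin smooth unfolding symmetric_tensor_def canonical_variation_def
    by (simp add: algebra_simps)
qed

text \<open>
  \<open>B\<close> stands for the adjoint of \<open>A_op D E\<close>. If \<open>X\<close> is orthogonal to \<open>E\<close>, the twist is the part orthogonal to
  \<open>E\<close> of the vector field dual to \<open>d\<omega>(X, \<cdot>)\<close>, as \<open>d\<omega>(X, W) = g(\<nabla>\<^sub>X E, W) - g(\<nabla>\<^sub>W E, X)\<close>.
\<close>

definition twist ::
  "'a metric \<Rightarrow> 'a connection \<Rightarrow> 'a vfield \<Rightarrow> ('a vfield \<Rightarrow> 'a vfield) \<Rightarrow> 'a vfield \<Rightarrow> 'a vfield" where
  "twist g D E B X = D X E - orthogonal_component g E (B X)"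

context
  fixes g :: "'a metric" and E :: "'a vfield" and D Dt :: "'a connection" and \<epsilon> t :: real
  assumes g: "symmetric_tensor \<A> g"
    and E: "E \<in> vector_fields \<A>"
    and eps: "\<And>p. pairing g E E p = \<epsilon>"
    and D: "levi_civita \<A> g D"
    and Dt: "levi_civita \<A> (canonical_variation g E t) Dt"
begin

abbreviation (input) "gt \<equiv> canonical_variation g E t"

lemmas gt_symmetric = symmetric_tensor_canonical_variation[OF g E, of t]
  and field_closed = E levi_civita_closed[OF D] levi_civita_closed[OF Dt]
    levi_civita_lie_bracket_closed[OF D] vector_fields_diff

lemma derivative_of_unit_orthogonal:
  assumes U: "U \<in> vector_fields \<A>"
  shows "pairing g E (D U E) p = 0" and "pairing g (D U E) E p = 0"
proof -
  have const: "pairing g E E = (\<lambda>q. \<epsilon>)"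
    using eps by auto
  have "pairing g (D U E) E p + pairing g E (D U E) p = 0"
    using levi_civita_compatible[OF D U E E, of p] apply_field_const[OF U] const by simp
  then show "pairing g E (D U E) p = 0" and "pairing g (D U E) E p = 0"
    using pairing_sym[OF g E, of "D U E" p] field_closed U by auto
qed

text \<open>
  The last summand is \<open>(\<nabla>\<^sub>U g\<^sub>t)(V, W)\<close>: it comes from \<open>\<omega> \<otimes> \<omega>\<close> alone, where
  \<open>(\<nabla>\<^sub>U \<omega>)(V) = g(\<nabla>\<^sub>U E, V)\<close>.
\<close>

lemma derivative_of_canonical_variation:
  assumes U: "U \<in> vector_fields \<A>" and V: "V \<in> vector_fields \<A>" and W: "W \<in> vector_fields \<A>"
  shows "apply_field U (pairing gt V W) p =
    pairing gt (D U V) W p + pairing gt V (D U W) p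
    + t * (pairing g (D U E) V p * pairing g E W p + pairing g E V p * pairing g (D U E) W p)"
proof -
  have variation: "pairing gt V W =
      (\<lambda>q. pairing g V W q + t * (pairing g E V q * pairing g E W q))"
    by (intro ext pairing_canonical_variation)
  have sum: "apply_field U (\<lambda>q. pairing g V W q + t * (pairing g E V q * pairing g E W q)) p =
      apply_field U (pairing g V W) p
      + t * apply_field U (\<lambda>q. pairing g E V q * pairing g E W q) p"
    using smooth_functions_mult[OF pairing_smooth[OF g E V] pairing_smooth[OF g E W]]
    by (intro apply_field_add_scale U pairing_smooth g V W) (simp add: times_fun_def)
  have product: "apply_field U (\<lambda>q. pairing g E V q * pairing g E W q) p =
      pairing g E V p * apply_field U (pairing g E W) p
      + pairing g E W p * apply_field U (pairing g E V) p"
    by (intro apply_field_mult U pairing_smooth g V W E)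
  show ?thesis
    unfolding variation sum product
    by (simp add: levi_civita_compatible[OF D] U V W E pairing_canonical_variation algebra_simps)
qed

text \<open>
  A trilinear form symmetric in its first two arguments is determined by its symmetrization in the last two,
  through a signed sum over the cyclic permutations. This is the argument for the uniqueness of
  the Levi-Civita connection, applied to \<open>g\<^sub>t(\<nabla>\<^sup>t\<^sub>U V - \<nabla>\<^sub>U V, W)\<close>. On the right, the first
  product contains the symmetric part of \<open>\<nabla>\<omega>\<close>, the other two contain \<open>d\<omega>\<close>.
\<close>

lemma difference_of_connections:
  assumes U: "U \<in> vector_fields \<A>" and V: "V \<in> vector_fields \<A>" and W: "W \<in> vector_fields \<A>"
  shows "pairing gt (Dt U V) W p = pairing gt (D U V) W p + t / 2 *
      ((pairing g (D U E) V p + pairing g (D V E) U p) * pairing g E W p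
     + (pairing g (D U E) W p - pairing g (D W E) U p) * pairing g E V p
     + (pairing g (D V E) W p - pairing g (D W E) V p) * pairing g E U p)"
proof -
  define C where "C U V W = pairing gt (Dt U V) W p - pairing gt (D U V) W p" for U V W
  have sym: "C U V W = C V U W"
    if U: "U \<in> vector_fields \<A>" and V: "V \<in> vector_fields \<A>" and W: "W \<in> vector_fields \<A>" for U V W
  proof -
    have "pairing gt (Dt U V) W p - pairing gt (Dt V U) W p =
        pairing gt (D U V) W p - pairing gt (D V U) W p"
      using levi_civita_torsion_free[OF D U V] levi_civita_torsion_free[OF Dt U V]
      by (simp flip: pairing_diff_left[OF gt_symmetric] add: field_closed that)
    then show ?thesis by (simp add: C_def)
  qed
  have compat: "C U V W + C U W V =
      t * (pairing g (D U E) V p * pairing g E W p + pairing g E V p * pairing g (D U E) W p)"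
    if U: "U \<in> vector_fields \<A>" and V: "V \<in> vector_fields \<A>" and W: "W \<in> vector_fields \<A>" for U V W
    using levi_civita_compatible[OF Dt U V W, of p] derivative_of_canonical_variation[OF U V W, of p]
      pairing_sym[OF gt_symmetric, of V "D U W" p] pairing_sym[OF gt_symmetric, of V "Dt U W" p]
    by (simp add: C_def field_closed that)
  \<comment> \<open>Each parenthesis is a symmetrization in the last two arguments.\<close>
  have "2 * C U V W = (C U V W + C U W V) + (C V U W + C V W U) - (C W U V + C W V U)"
    using sym[OF U V W] sym[OF U W V] sym[OF V W U] by simp
  then show ?thesis
    unfolding compat[OF U V W] compat[OF V U W] compat[OF W U V]
    by (simp add: C_def field_simps)
qed

text \<open>
  Only \<open>d\<omega>(E, W) = g(\<nabla>\<^sub>E E, W)\<close> contributes to the difference of the connections. On the right \<open>g\<close> may be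
  read as \<open>g\<^sub>t\<close>, because \<open>\<nabla>\<^sub>E E\<close> is orthogonal to \<open>E\<close>.
\<close>

lemma variation_acceleration:
  assumes W: "W \<in> vector_fields \<A>"
  shows "pairing gt (Dt E E) W p = (1 + t * \<epsilon>) * pairing g (D E E) W p"
  using difference_of_connections[OF E E W, of p]
  by (simp add: pairing_canonical_variation derivative_of_unit_orthogonal W E eps algebra_simps)


text \<open>
  Since \<open>\<omega>\<close> vanishes on \<open>X\<close> and \<open>N\<close>, the difference of the connections retains the single term
  \<open>d\<omega>(X, N) \<omega>(E)\<close>.
\<close>

lemma variation_derivative_along_E:
  assumes X: "X \<in> vector_fields \<A>" "\<And>p. pairing g E X p = 0"
    and N: "N \<in> vector_fields \<A>" "\<And>p. pairing g E N p = 0"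
  shows "pairing g N (Dt E X) p = pairing g N (D E X) p
    + t * \<epsilon> / 2 * (pairing g N (D X E) p - pairing g (D N E) X p)"
  using difference_of_connections[OF E X(1) N(1), of p]
    pairing_sym[OF g, of N "Dt E X" p] pairing_sym[OF g, of N "D E X" p]
    pairing_sym[OF g, of N "D X E" p]
  by (simp add: pairing_canonical_variation X N field_closed eps)

context
  fixes X :: "'a vfield" and B :: "'a vfield \<Rightarrow> 'a vfield"
  assumes eps_nonzero: "\<epsilon> \<noteq> 0"
    and X: "X \<in> vector_fields \<A>"
    and XE: "\<And>p. pairing g E X p = 0"
    and adjoint: "is_adjoint \<A> g (A_op D E) B"
begin

abbreviation (input) "P \<equiv> orthogonal_component g E (B X)"

abbreviation (input) "H \<equiv> twist g D E B X"

lemma adjoint_closed: "B X \<in> vector_fields \<A>"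
  using adjoint X unfolding is_adjoint_def by blast

lemma P_closed: "P \<in> vector_fields \<A>"
  by (rule vector_fields_orthogonal_component[OF E adjoint_closed pairing_smooth eps])
    (intro g E adjoint_closed)+

lemma twist_closed: "H \<in> vector_fields \<A>"
  unfolding twist_def by (intro field_closed X P_closed)

text \<open>
  The left side is \<open>g(A\<^sup>* X, V)\<close>. The component of \<open>A\<^sup>* X\<close> along \<open>E\<close> is known, since
  \<open>g(A\<^sup>* X, E) = g(X, \<nabla>\<^sub>E E)\<close>.
\<close>

lemma pairing_derivative_of_E:
  assumes V: "V \<in> vector_fields \<A>"
  shows "pairing g (D V E) X p =
    pairing g P V p + pairing g (D E E) X p * pairing g E V p / \<epsilon>"
proof -
  have adj: "pairing g (D V E) X p = pairing g (B X) V p"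
    if "V \<in> vector_fields \<A>" for V
    using adjoint X that pairing_sym[OF g adjoint_closed that]
    unfolding is_adjoint_def A_op_def by metis
  have "pairing g P V p =
      pairing g (B X) V p - pairing g (B X) E p / pairing g E E p * pairing g E V p"
    unfolding orthogonal_component_def
    using smooth_functions_scale[OF pairing_smooth[OF g adjoint_closed E], of "inverse \<epsilon>"]
    by (subst pairing_diff_left[OF g adjoint_closed _ V])
      (auto simp: pairing_fscale_left[OF g E V] eps divide_inverse mult.commute
        intro!: vector_fields_fscale E)
  then show ?thesis
    using adj[OF V] adj[OF E] by (simp add: eps)
qed

lemma P_orthogonal: "pairing g E P p = 0"
  using pairing_derivative_of_E[OF E, of p] eps_nonzero pairing_sym[OF g P_closed E, of p]
  by (simp add: eps)

lemma twist_orthogonal: "pairing g E H p = 0"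
  unfolding twist_def
  by (simp add: pairing_diff_right[OF g] field_closed X P_closed P_orthogonal
      derivative_of_unit_orthogonal)

lemma pairing_twist:
  assumes V: "V \<in> vector_fields \<A>"
  shows "pairing g H V p = pairing g (D X E) V p - pairing g P V p"
  unfolding twist_def by (simp add: pairing_diff_left[OF g] field_closed X P_closed V)

text \<open>
  The symmetric part of \<open>\<nabla>\<omega>\<close> contributes \<open>g(\<nabla>\<^sub>E E, X) \<omega>(W)\<close>, which cancels the component
  of \<open>d\<omega>(X, \<cdot>)\<close> along \<open>\<omega>\<close>. What is left of \<open>d\<omega>(X, \<cdot>)\<close> is the twist.
\<close>

lemma variation_derivative_of_E:
  assumes W: "W \<in> vector_fields \<A>"
  shows "pairing gt (Dt X E) W p = pairing g (D X E) W p + t * \<epsilon> / 2 * pairing g H W p"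
proof -
  have "(pairing g (D X E) W p - pairing g (D W E) X p) * \<epsilon> =
      \<epsilon> * pairing g H W p - pairing g (D E E) X p * pairing g E W p"
    using eps_nonzero by (simp add: pairing_derivative_of_E W pairing_twist field_simps)
  then show ?thesis
    using difference_of_connections[OF X E W, of p]
    by (simp only: pairing_canonical_variation derivative_of_unit_orthogonal X XE W E eps)
      (simp add: algebra_simps)
qed

text \<open>
  This expresses \<open>d\<omega>(X, X) = 0\<close>.
\<close>

lemma twist_alternating: "pairing g H X p = 0"
  using pairing_twist[OF X, of p] pairing_derivative_of_E[OF X, of p] by (simp add: XE)

text \<open>
  The three terms of \<open>pairing_curvature\<close> are compared one by one. The pairing of the twist with
  \<open>\<nabla>\<^sub>E X\<close> occurs in the second and, through \<open>[X, E] = \<nabla>\<^sub>X E - \<nabla>\<^sub>E X\<close>, in the third, where it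
  cancels.
\<close>

lemma variation_curvature:
  "pairing gt (curvature Dt X E E) X p - pairing g (curvature D X E E) X p =
     t * \<epsilon> * pairing g (D X (D E E)) X p - t * (pairing g (D E E) X p)\<^sup>2
     + t * \<epsilon> / 2 * (2 * pairing g (D X E) H p + t * \<epsilon> / 2 * pairing g H H p)"
proof -
  let ?a = "pairing g (D E E) X p"
  let ?L = "lie_bracket X E"
  have L: "?L \<in> vector_fields \<A>" by (intro field_closed X)
  have along_X: "apply_field X (pairing gt (Dt E E) X) p - pairing gt (Dt E E) (Dt X X) p =
      (1 + t * \<epsilon>) * pairing g (D X (D E E)) X p"
  proof -
    have "apply_field X (pairing gt (Dt E E) X) p =
        (1 + t * \<epsilon>) * apply_field X (pairing g (D E E) X) p"
      using apply_field_scale[OF X pairing_smooth[OF g _ X], of "D E E" "1 + t * \<epsilon>" p]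
      by (simp add: variation_acceleration[OF X, abs_def] field_closed)
    moreover have "pairing g (D E E) (Dt X X) p = pairing g (D E E) (D X X) p"
      using difference_of_connections[OF X X, of "D E E" p]
        pairing_sym[OF g, of "D E E" "Dt X X" p] pairing_sym[OF g, of "D E E" "D X X" p]
      by (simp add: pairing_canonical_variation derivative_of_unit_orthogonal XE X field_closed)
    ultimately show ?thesis
      using levi_civita_compatible[OF D X, of "D E E" X p]
      by (simp add: variation_acceleration field_closed X algebra_simps)
  qed
  have along_E: "apply_field E (pairing gt (Dt X E) X) p = apply_field E (pairing g (D X E) X) p"
  proof -
    have "pairing gt (Dt X E) X = pairing g (D X E) X"
      using variation_derivative_of_E[OF X] twist_alternating by auto
    then show ?thesis by simp
  qed
  have sum: "pairing gt (Dt X E) (Dt E X) p - pairing g (D X E) (D E X) p =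
      t * \<epsilon> / 2 * (pairing g (D X E) H p + pairing g H (D E X) p
        + t * \<epsilon> / 2 * pairing g H H p)"
  proof -
    \<comment> \<open>It is applied to \<open>N = \<nabla>\<^sub>X E\<close> and to \<open>N = H\<close>, the two parts of \<open>\<nabla>\<^sup>t\<^sub>X E\<close>.\<close>
    have *: "pairing g N (Dt E X) p = pairing g N (D E X) p + t * \<epsilon> / 2 * pairing g N H p"
      if N: "N \<in> vector_fields \<A>" "\<And>p. pairing g E N p = 0" for N
      using variation_derivative_along_E[OF X XE N, of p] pairing_derivative_of_E[OF N(1), of p]
        N(2)[of p] pairing_twist[OF N(1), of p] pairing_sym[OF g N(1), of H p]
        pairing_sym[OF g N(1), of "D X E" p]
      by (simp add: twist_closed field_closed X)
    show ?thesis
      by (simp add: variation_derivative_of_E field_closed X * twist_closed twist_orthogonal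
          derivative_of_unit_orthogonal field_simps)
  qed
  have bracket: "pairing gt (Dt ?L E) X p - pairing g (D ?L E) X p =
      t * ?a\<^sup>2 - t * \<epsilon> / 2 * (pairing g (D X E) H p - pairing g H (D E X) p)"
  proof -
    have "pairing g E (D E X) p = - ?a"
    proof -
      have "pairing g E X = (\<lambda>q. 0)"
        using XE by blast
      then show ?thesis
        using levi_civita_compatible[OF D E E X, of p] apply_field_const[OF E, of 0 p] by simp
    qed
    then have EL: "pairing g E ?L p = ?a"
      by (simp add: levi_civita_torsion_free[OF D X E] pairing_diff_right[OF g]
          field_closed X derivative_of_unit_orthogonal)
    have "pairing g H ?L p = pairing g (D X E) H p - pairing g H (D E X) p"
      using pairing_sym[OF g twist_closed, of "D X E" p]
      by (simp add: levi_civita_torsion_free[OF D X E] pairing_diff_right[OF g]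
          field_closed X twist_closed)
    then have "pairing g (D X E) ?L p - pairing g P ?L p =
        pairing g (D X E) H p - pairing g H (D E X) p"
      using pairing_twist[OF L, of p] by simp
    moreover have "(pairing g (D ?L E) X p - pairing g (D X E) ?L p) * \<epsilon> =
        ?a\<^sup>2 - \<epsilon> * (pairing g (D X E) ?L p - pairing g P ?L p)"
      using pairing_derivative_of_E[OF L, of p] EL eps_nonzero
      by (simp add: power2_eq_square field_simps)
    ultimately have "(pairing g (D ?L E) X p - pairing g (D X E) ?L p) * \<epsilon> =
        ?a\<^sup>2 - \<epsilon> * (pairing g (D X E) H p - pairing g H (D E X) p)"
      by simp
    then show ?thesis
      using difference_of_connections[OF L E X, of p]
      by (simp only: pairing_canonical_variation derivative_of_unit_orthogonal X XE L E eps EL)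
        (simp add: algebra_simps power2_eq_square)
  qed
  have "pairing gt (curvature Dt X E E) X p - pairing g (curvature D X E E) X p =
      t * \<epsilon> * pairing g (D X (D E E)) X p
      + (pairing gt (Dt X E) (Dt E X) p - pairing g (D X E) (D E X) p)
      - (pairing gt (Dt ?L E) X p - pairing g (D ?L E) X p)"
    using along_X along_E levi_civita_compatible[OF D X, of "D E E" X p]
      distrib_right[of 1 "t * \<epsilon>" "pairing g (D X (D E E)) X p"]
    unfolding pairing_curvature[OF g D X E E X] pairing_curvature[OF gt_symmetric Dt X E E X]
    by (simp add: field_closed X)
  also have "\<dots> = t * \<epsilon> * pairing g (D X (D E E)) X p - t * ?a\<^sup>2
      + t * \<epsilon> / 2 * (2 * pairing g (D X E) H p + t * \<epsilon> / 2 * pairing g H H p)"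
    unfolding sum bracket by (simp add: algebra_simps)
  finally show ?thesis .
qed

lemma pairing_derivative_twist:
  "pairing g (D X E) H p = pairing g (D X E) (D X E) p - pairing g (D (D X E) E) X p"
proof -
  have AX: "D X E \<in> vector_fields \<A>"
    by (intro field_closed X)
  show ?thesis
    using pairing_twist[OF AX, of p] pairing_derivative_of_E[OF AX, of p]
      pairing_sym[OF g twist_closed AX, of p]
    by (simp add: derivative_of_unit_orthogonal X)
qed

text \<open>
  In \<open>g(H, H) = g(A X, A X) - 2 g(A X, P) + g(P, P)\<close> the outer terms agree by assumption, which is
  the condition of orthogonal normality at \<open>X\<close>.
\<close>

lemma twist_square:
  assumes "pairing g (D X E) (D X E) p = pairing g P P p"
  shows "pairing g H H p = 2 * pairing g (D X E) H p"
proof -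
  have AX: "D X E \<in> vector_fields \<A>"
    by (intro field_closed X)
  show ?thesis
    using assms pairing_twist[OF AX, of p] pairing_twist[OF P_closed, of p]
      pairing_twist[OF twist_closed, of p]
      pairing_sym[OF g twist_closed AX, of p] pairing_sym[OF g twist_closed P_closed, of p]
      pairing_sym[OF g P_closed AX, of p]
    by simp
qed

end

end

end

theorem theorem3p2:
  fixes \<A> :: "('a::{t2_space,second_countable_topology}, 'b::euclidean_space) chart set"
    and g :: "'a metric"
    and E X :: "'a vfield"
    and D Dt :: "'a connection"
    and \<epsilon> t :: real
  assumes manifold: "smooth_atlas \<A>"
    and metric: "riemannian_metric \<A> g \<or> lorentzian_metric \<A> g"
    and unitary: "unitary_field \<A> g E"
    and timelike: "lorentzian_metric \<A> g \<Longrightarrow> timelike_field g E"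
    and eps: "\<And>p. \<epsilon> = pairing g E E p"
    and t: "t \<noteq> - \<epsilon>"
    and D: "levi_civita \<A> g D"
    and Dt: "levi_civita \<A> (canonical_variation g E t) Dt"
    and normal: "orthogonally_normal \<A> g E (A_op D E)"
    and X: "X \<in> orthogonal_fields \<A> g E"
  shows "pairing (canonical_variation g E t) (curvature Dt X E E) X p =
    pairing g (curvature D X E E) X p
    + t * (\<epsilon> * pairing g (D X (A_op D E E)) X p - (pairing g (A_op D E E) X p)\<^sup>2)
    + t * (2 * \<epsilon> + t) / 2 *
        (pairing g (A_op D E X) (A_op D E X) p - pairing g (A_op D E (A_op D E X)) X p)"
proof -
  have g: "symmetric_tensor \<A> g"
    using metric unfolding riemannian_metric_def lorentzian_metric_def by blast
  have E: "E \<in> vector_fields \<A>" and "\<epsilon> = 1 \<or> \<epsilon> = - 1"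
    using unitary eps unfolding unitary_field_def by auto
  then have nonzero: "\<epsilon> \<noteq> 0" and square: "\<epsilon> * \<epsilon> = 1"
    by auto
  have X': "X \<in> vector_fields \<A>" and XE: "pairing g E X q = 0" for q
    using X pairing_sym[OF manifold g E, of X q] unfolding orthogonal_fields_def by auto
  obtain B where B: "is_adjoint \<A> g (A_op D E) B"
    and norm: "pairing g (A_op D E X) (A_op D E X) =
      pairing g (orthogonal_component g E (B X)) (orthogonal_component g E (B X))"
    using normal X unfolding orthogonally_normal_def by blast
  from norm have norm: "pairing g (D X E) (D X E) p =
      pairing g (orthogonal_component g E (B X)) (orthogonal_component g E (B X)) p"
    unfolding A_op_def by (rule fun_cong)
  note setting = manifold g E eps[symmetric] D
  let ?Q = "pairing g (D X E) (D X E) p - pairing g (D (D X E) E) X p"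
  have "pairing (canonical_variation g E t) (curvature Dt X E E) X p
      - pairing g (curvature D X E E) X p =
      t * \<epsilon> * pairing g (D X (D E E)) X p - t * (pairing g (D E E) X p)\<^sup>2
      + t * \<epsilon> / 2 * (2 * ?Q + t * \<epsilon> / 2 * (2 * ?Q))"
    unfolding variation_curvature[OF setting Dt nonzero X' XE B]
      twist_square[OF setting Dt nonzero X' XE B, OF norm]
      pairing_derivative_twist[OF setting Dt nonzero X' XE B] ..
  moreover have "t * \<epsilon> / 2 * (2 * ?Q + t * \<epsilon> / 2 * (2 * ?Q)) = t * (2 * \<epsilon> + t * (\<epsilon> * \<epsilon>)) / 2 * ?Q"
    by (simp add: field_simps)
  moreover have "t * \<epsilon> * pairing g (D X (D E E)) X p - t * (pairing g (D E E) X p)\<^sup>2 =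
      t * (\<epsilon> * pairing g (D X (D E E)) X p - (pairing g (D E E) X p)\<^sup>2)"
    by (simp add: algebra_simps)
  ultimately show ?thesis
    unfolding square A_op_def mult_1_right by linarith
qed

end
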